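(* Let $L$ be a residuated lattice and let $\mathcal{F}=\{F_i:i\in I\}$ be a system of filters of $L$. Then the following statements are equivalent: (i) $(L,\mathcal{T}_{\mathcal F})$ is a Hausdorff space; (ii) $(L,\mathcal{T}_{\mathcal F})$ is a $T_1$-space; (iii) $(L,\mathcal{T}_{\mathcal F})$ is a $T_0$-space; (iv) $\bigcap_{i\in I}F_i=\{1\}$; (v) $L$ is a subdirect product of the family $(L/F_i)_{i\in I}$ of residuated lattices.
   Context: A residuated lattice is an algebra $(L,\wedge,\vee,\odot,\rightarrow,0,1)$ such that $(L,\wedge,\vee,0,1)$ is a bounded lattice, $(L,\odot,1)$ is a commutative monoid, and $x\odot y\leq z$ iff $x\leq y\rightarrow z$ for all $x,y,z\in L$. A filter of $L$ is a nonempty subset $F\subseteq L$ closed under $\odot$ and upward closed. For a filter $F$, $\theta_F=\{(x,y)\in L\times L:(x\to y)\odot(y\to x)\in F\}$ is a congruence of $L$; $x/F$ denotes the $\theta_F$-class of $x$ and $L/F$ the quotient residuated lattice $L/\theta_F$. A system of filters of $L$ is a nonempty family $\mathcal F$ of filters that is down-directed under inclusion: for all $F,G\in\mathcal F$ there is $H\in\mathcal F$ with $H\subseteq F\cap G$. It induces the topology $\mathcal T_{\mathcal F}=\{U\subseteq L:\forall x\in U\ \exists F\in\mathcal F,\ x/F\subseteq U\}$ on $L$. A residuated lattice $L$ is a subdirect product of a family $(L_i)_{i\in I}$ of residuated lattices if there is a subdirect embedding $h:L\to\prod_{i\in I}L_i$, that is, an injective homomorphism whose composition with each coordinate projection $\prod_{i\in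 I}L_i\to L_j$ is onto.
   Formalization: In (v) the subdirect embedding is taken to be the natural map x ↦ (x/F_i); with an arbitrary embedding (v) ⇒ (iv) fails, e.g. L = Pow(ℕ) with the single filter {ℕ, ℕ∖{0}}, where L/F ≅ L. *)

theory Defs
  imports "HOL-Analysis.Abstract_Topological_Spaces" "HOL-Algebra.Group"
begin

record 'a rlattice = "'a monoid" +
  rmeet :: "['a, 'a] \<Rightarrow> 'a" (infixl \<open>\<curlywedge>\<index>\<close> 70)
  rjoin :: "['a, 'a] \<Rightarrow> 'a" (infixl \<open>\<curlyvee>\<index>\<close> 65)
  rimp :: "['a, 'a] \<Rightarrow> 'a" (infixr \<open>\<leadsto>\<index>\<close> 60)
  rbot :: 'a (\<open>\<zero>\<index>\<close>)

definition rle :: "('a, 'b) rlattice_scheme \<Rightarrow> 'a \<Rightarrow> 'a \<Rightarrow> bool" (infix \<open>\<preceq>\<index>\<close> 50)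
  where "x \<preceq>\<^bsub>L\<^esub> y \<longleftrightarrow> x \<curlywedge>\<^bsub>L\<^esub> y = x"

text \<open>The monoid unit is also the top element of the lattice. The case of a one-element algebra
  (bottom equal to top) is allowed.\<close>

locale residuated_lattice = comm_monoid L
  for L :: "('a, 'b) rlattice_scheme" (structure) +
  assumes meet_closed: "\<lbrakk>x \<in> carrier L; y \<in> carrier L\<rbrakk> \<Longrightarrow> x \<curlywedge> y \<in> carrier L"
    and join_closed: "\<lbrakk>x \<in> carrier L; y \<in> carrier L\<rbrakk> \<Longrightarrow> x \<curlyvee> y \<in> carrier L"
    and imp_closed: "\<lbrakk>x \<in> carrier L; y \<in> carrier L\<rbrakk> \<Longrightarrow> x \<leadsto> y \<in> carrier L"
    and bot_closed: "\<zero> \<in> carrier L"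
    and meet_comm: "\<lbrakk>x \<in> carrier L; y \<in> carrier L\<rbrakk> \<Longrightarrow> x \<curlywedge> y = y \<curlywedge> x"
    and join_comm: "\<lbrakk>x \<in> carrier L; y \<in> carrier L\<rbrakk> \<Longrightarrow> x \<curlyvee> y = y \<curlyvee> x"
    and meet_assoc: "\<lbrakk>x \<in> carrier L; y \<in> carrier L; z \<in> carrier L\<rbrakk>
      \<Longrightarrow> (x \<curlywedge> y) \<curlywedge> z = x \<curlywedge> (y \<curlywedge> z)"
    and join_assoc: "\<lbrakk>x \<in> carrier L; y \<in> carrier L; z \<in> carrier L\<rbrakk>
      \<Longrightarrow> (x \<curlyvee> y) \<curlyvee> z = x \<curlyvee> (y \<curlyvee> z)"
    and meet_join_absorb: "\<lbrakk>x \<in> carrier L; y \<in> carrier L\<rbrakk> \<Longrightarrow> x \<curlywedge> (x \<curlyvee> y) = x"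
    and join_meet_absorb: "\<lbrakk>x \<in> carrier L; y \<in> carrier L\<rbrakk> \<Longrightarrow> x \<curlyvee> (x \<curlywedge> y) = x"
    and bot_least: "x \<in> carrier L \<Longrightarrow> \<zero> \<preceq> x"
    and one_greatest: "x \<in> carrier L \<Longrightarrow> x \<preceq> \<one>"
    and residuation: "\<lbrakk>x \<in> carrier L; y \<in> carrier L; z \<in> carrier L\<rbrakk>
      \<Longrightarrow> x \<otimes> y \<preceq> z \<longleftrightarrow> x \<preceq> y \<leadsto> z"

definition rl_filter :: "('a, 'b) rlattice_scheme \<Rightarrow> 'a set \<Rightarrow> bool"
  where "rl_filter L F \<longleftrightarrow> F \<subseteq> carrier L \<and> F \<noteq> {} \<and>
    (\<forall>x\<in>F. \<forall>y\<in>F. x \<otimes>\<^bsub>L\<^esub> y \<in> F) \<and>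
    (\<forall>x\<in>F. \<forall>y\<in>carrier L. x \<preceq>\<^bsub>L\<^esub> y \<longrightarrow> y \<in> F)"

definition filter_system :: "('a, 'b) rlattice_scheme \<Rightarrow> 'a set set \<Rightarrow> bool"
  where "filter_system L \<F> \<longleftrightarrow> \<F> \<noteq> {} \<and> (\<forall>F\<in>\<F>. rl_filter L F) \<and>
    (\<forall>F\<in>\<F>. \<forall>G\<in>\<F>. \<exists>H\<in>\<F>. H \<subseteq> F \<inter> G)"

definition filter_cong :: "('a, 'b) rlattice_scheme \<Rightarrow> 'a set \<Rightarrow> ('a \<times> 'a) set"
  where "filter_cong L F = {(x, y). x \<in> carrier L \<and> y \<in> carrier L \<and>
    (x \<leadsto>\<^bsub>L\<^esub> y) \<otimes>\<^bsub>L\<^esub> (y \<leadsto>\<^bsub>L\<^esub> x) \<in> F}"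

definition filter_class :: "('a, 'b) rlattice_scheme \<Rightarrow> 'a set \<Rightarrow> 'a \<Rightarrow> 'a set"
  where "filter_class L F x = filter_cong L F `` {x}"

text \<open>Operations on classes are given by the union, over all representatives, of the class of the
  result; since the relation is a congruence, this union is a single class.\<close>

definition lift2_class ::
    "('a, 'b) rlattice_scheme \<Rightarrow> 'a set \<Rightarrow> ('a \<Rightarrow> 'a \<Rightarrow> 'a) \<Rightarrow> 'a set \<Rightarrow> 'a set \<Rightarrow> 'a set"
  where "lift2_class L F f A B = (\<Union>a\<in>A. \<Union>b\<in>B. filter_class L F (f a b))"

definition rl_quotient :: "('a, 'b) rlattice_scheme \<Rightarrow> 'a set \<Rightarrow> 'a set rlattice"
  where "rl_quotient L F =
    \<lparr>carrier = carrier L // filter_cong L F,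
     mult = lift2_class L F (mult L),
     one = filter_class L F \<one>\<^bsub>L\<^esub>,
     rmeet = lift2_class L F (rmeet L),
     rjoin = lift2_class L F (rjoin L),
     rimp = lift2_class L F (rimp L),
     rbot = filter_class L F \<zero>\<^bsub>L\<^esub>\<rparr>"

definition filter_topology :: "('a, 'b) rlattice_scheme \<Rightarrow> 'a set set \<Rightarrow> 'a topology"
  where "filter_topology L \<F> =
    topology (\<lambda>U. U \<subseteq> carrier L \<and> (\<forall>x\<in>U. \<exists>F\<in>\<F>. filter_class L F x \<subseteq> U))"

lemma openin_filter_topology:
  assumes "filter_system L \<F>"
  shows "openin (filter_topology L \<F>) U \<longleftrightarrow>
    U \<subseteq> carrier L \<and> (\<forall>x\<in>U. \<exists>F\<in>\<F>. filter_class L F x \<subseteq> U)"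
proof -
  have mono: "filter_class L H x \<subseteq> filter_class L F x" if "H \<subseteq> F" for F H x
    using that by (auto simp: filter_class_def filter_cong_def)
  have inter: "\<exists>H\<in>\<F>. filter_class L H x \<subseteq> S \<inter> T"
    if "\<exists>F\<in>\<F>. filter_class L F x \<subseteq> S" "\<exists>G\<in>\<F>. filter_class L G x \<subseteq> T" for x S T
  proof -
    from that obtain F G where FG: "F \<in> \<F>" "G \<in> \<F>"
      "filter_class L F x \<subseteq> S" "filter_class L G x \<subseteq> T" by blast
    with assms obtain H where "H \<in> \<F>" "H \<subseteq> F" "H \<subseteq> G"
      unfolding filter_system_def by (meson le_inf_iff)
    with FG mono show ?thesis by (meson le_inf_iff order_trans)
  qed
  have "istopology (\<lambda>U. U \<subseteq> carrier L \<and> (\<forall>x\<in>U. \<exists>F\<in>\<F>. filter_class L F x \<subseteq> U))"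
    unfolding istopology_def
  proof (intro conjI allI impI, goal_cases)
    case 1
    then show ?case by blast
  next
    case 2
    then show ?case using inter by (metis IntD1 IntD2)
  next
    case 3
    then show ?case by blast
  next
    case 4
    then show ?case by (meson Union_iff Union_upper order_trans)
  qed
  then show ?thesis
    by (simp add: filter_topology_def)
qed

lemma topspace_filter_topology:
  assumes "filter_system L \<F>"
  shows "topspace (filter_topology L \<F>) = carrier L"
proof -
  have "openin (filter_topology L \<F>) (carrier L)"
    using assms unfolding openin_filter_topology[OF assms]
    by (auto simp: filter_system_def filter_class_def filter_cong_def)
  then show ?thesis
    using openin_filter_topology[OF assms] by (metis openin_subset openin_topspace subset_antisym)
qed

definition rl_hom :: "('a, 'b) rlattice_scheme \<Rightarrow> ('c, 'd) rlattice_scheme \<Rightarrow> ('a \<Rightarrow> 'c) set"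
  where "rl_hom L M = {h \<in> hom L M.
    (\<forall>x\<in>carrier L. \<forall>y\<in>carrier L.
      h (x \<curlywedge>\<^bsub>L\<^esub> y) = h x \<curlywedge>\<^bsub>M\<^esub> h y \<and>
      h (x \<curlyvee>\<^bsub>L\<^esub> y) = h x \<curlyvee>\<^bsub>M\<^esub> h y \<and>
      h (x \<leadsto>\<^bsub>L\<^esub> y) = h x \<leadsto>\<^bsub>M\<^esub> h y) \<and>
    h \<zero>\<^bsub>L\<^esub> = \<zero>\<^bsub>M\<^esub> \<and> h \<one>\<^bsub>L\<^esub> = \<one>\<^bsub>M\<^esub>}"

definition rl_product :: "'i set \<Rightarrow> ('i \<Rightarrow> ('a, 'b) rlattice_scheme) \<Rightarrow> ('i \<Rightarrow> 'a) rlattice"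
  where "rl_product I M =
    \<lparr>carrier = (\<Pi>\<^sub>E i\<in>I. carrier (M i)),
     mult = (\<lambda>u v. \<lambda>i\<in>I. u i \<otimes>\<^bsub>M i\<^esub> v i),
     one = (\<lambda>i\<in>I. \<one>\<^bsub>M i\<^esub>),
     rmeet = (\<lambda>u v. \<lambda>i\<in>I. u i \<curlywedge>\<^bsub>M i\<^esub> v i),
     rjoin = (\<lambda>u v. \<lambda>i\<in>I. u i \<curlyvee>\<^bsub>M i\<^esub> v i),
     rimp = (\<lambda>u v. \<lambda>i\<in>I. u i \<leadsto>\<^bsub>M i\<^esub> v i),
     rbot = (\<lambda>i\<in>I. \<zero>\<^bsub>M i\<^esub>)\<rparr>"

definition subdirect_embedding ::
    "('a, 'b) rlattice_scheme \<Rightarrow> 'i set \<Rightarrow> ('i \<Rightarrow> ('c, 'd) rlattice_scheme) \<Rightarrow> ('a \<Rightarrow> 'i \<Rightarrow> 'c) \<Rightarrow> bool"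
  where "subdirect_embedding L I M h \<longleftrightarrow>
    h \<in> rl_hom L (rl_product I M) \<and> inj_on h (carrier L) \<and>
    (\<forall>j\<in>I. (\<lambda>x. h x j) ` carrier L = carrier (M j))"

text \<open>\<open>L\<close> is a subdirect product of the residuated lattices \<open>M i\<close>, \<open>i \<in> I\<close>, with \<open>h\<close> the subdirect
  embedding that represents it as such. The embedding is an explicit argument because being a
  subdirect product of a family of quotients \<open>L/F i\<close> is understood with respect to the natural map
  \<open>x \<mapsto> (x/F i)\<^sub>i\<close>. With an arbitrary embedding, being a subdirect product would not imply that the
  intersection of the \<open>F i\<close> is trivial: for the power set of the natural numbers and
  the single filter \<open>F\<close> consisting of UNIV and \<open>UNIV - {0}\<close>, the quotient is isomorphic to \<open>L\<close>.\<close>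

definition subdirect_product_via ::
    "('a, 'b) rlattice_scheme \<Rightarrow> 'i set \<Rightarrow> ('i \<Rightarrow> ('c, 'd) rlattice_scheme) \<Rightarrow> ('a \<Rightarrow> 'i \<Rightarrow> 'c) \<Rightarrow> bool"
  where "subdirect_product_via L I M h \<longleftrightarrow>
    residuated_lattice L \<and> (\<forall>i\<in>I. residuated_lattice (M i)) \<and> subdirect_embedding L I M h"

definition subdirect_product ::
    "('a, 'b) rlattice_scheme \<Rightarrow> 'i set \<Rightarrow> ('i \<Rightarrow> ('c, 'd) rlattice_scheme) \<Rightarrow> bool"
  where "subdirect_product L I M \<longleftrightarrow> (\<exists>h. subdirect_product_via L I M h)"

lemma subdirect_product_viaD: "subdirect_product_via L I M h \<Longrightarrow> subdirect_product L I M"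
  unfolding subdirect_product_def by blast

definition natural_map ::
    "('a, 'b) rlattice_scheme \<Rightarrow> 'i set \<Rightarrow> ('i \<Rightarrow> 'a set) \<Rightarrow> 'a \<Rightarrow> 'i \<Rightarrow> 'a set"
  where "natural_map L I F x = (\<lambda>i\<in>I. filter_class L (F i) x)"

end

(* For a filter F, x \<leadsto> y \<in> F iff f x \<le> y for some f \<in> F. So F induces a preorder on L which the
   operations respect (contravariantly in the first argument of \<leadsto>); its symmetric kernel is
   the congruence of F, and the order of L/F is the order induced by this preorder.
   The classes are open and partition L, so points separated by some F have disjoint neighbourhoods,
   and an element of all the F i has the same neighbourhoods as 1. *)
theory Submission
  imports Defs
begin

context residuated_lattice
begin

section \<open>Order and residuation\<close>

lemmas rl_closed = meet_closed join_closed imp_closed bot_closed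

text \<open>Absorption twice: one law rewrites the second \<open>x\<close> as
  \<open>x \<curlyvee> (x \<curlywedge> x)\<close>, the other removes the join.\<close>

lemma meet_idem: "x \<in> carrier L \<Longrightarrow> x \<curlywedge> x = x"
  by (metis join_meet_absorb meet_closed meet_join_absorb)

lemma rle_refl: "x \<in> carrier L \<Longrightarrow> x \<preceq> x"
  by (simp add: rle_def meet_idem)

lemma rle_antisym: "\<lbrakk>x \<preceq> y; y \<preceq> x; x \<in> carrier L; y \<in> carrier L\<rbrakk> \<Longrightarrow> x = y"
  unfolding rle_def by (metis meet_comm)

lemma rle_trans: "\<lbrakk>x \<preceq> y; y \<preceq> z; x \<in> carrier L; y \<in> carrier L; z \<in> carrier L\<rbrakk> \<Longrightarrow> x \<preceq> z"
  unfolding rle_def by (metis meet_assoc)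

lemma rle_meetI:
  "\<lbrakk>z \<preceq> x; z \<preceq> y; x \<in> carrier L; y \<in> carrier L; z \<in> carrier L\<rbrakk> \<Longrightarrow> z \<preceq> x \<curlywedge> y"
  unfolding rle_def by (metis meet_assoc)

lemma meet_rle1: "\<lbrakk>x \<in> carrier L; y \<in> carrier L\<rbrakk> \<Longrightarrow> x \<curlywedge> y \<preceq> x"
  unfolding rle_def by (metis meet_assoc meet_closed meet_comm meet_idem)

lemma meet_rle2: "\<lbrakk>x \<in> carrier L; y \<in> carrier L\<rbrakk> \<Longrightarrow> x \<curlywedge> y \<preceq> y"
  by (metis meet_comm meet_rle1)

text \<open>The order is defined through the meet; absorption translates it to the join, which
  \<open>join_rleI\<close> relies on.\<close>

lemma rle_iff_join: "\<lbrakk>x \<in> carrier L; y \<in> carrier L\<rbrakk> \<Longrightarrow> x \<preceq> y \<longleftrightarrow> x \<curlyvee> y = y"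
  unfolding rle_def by (metis join_comm join_meet_absorb meet_comm meet_join_absorb)

lemma rle_join1: "\<lbrakk>x \<in> carrier L; y \<in> carrier L\<rbrakk> \<Longrightarrow> x \<preceq> x \<curlyvee> y"
  by (simp add: rle_def meet_join_absorb)

lemma rle_join2: "\<lbrakk>x \<in> carrier L; y \<in> carrier L\<rbrakk> \<Longrightarrow> y \<preceq> x \<curlyvee> y"
  by (metis join_comm rle_join1)

lemma join_rleI:
  "\<lbrakk>x \<preceq> z; y \<preceq> z; x \<in> carrier L; y \<in> carrier L; z \<in> carrier L\<rbrakk> \<Longrightarrow> x \<curlyvee> y \<preceq> z"
  by (metis join_assoc join_closed rle_iff_join)

text \<open>Residuation turns \<open>y \<otimes> z \<preceq> y \<otimes> z\<close> into a bound on
  \<open>y\<close>, which also bounds \<open>x\<close>; residuating back gives the claim.\<close>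

lemma mult_mono_left:
  assumes "x \<preceq> y" and [simp]: "x \<in> carrier L" "y \<in> carrier L" "z \<in> carrier L"
  shows "x \<otimes> z \<preceq> y \<otimes> z"
proof -
  have "y \<preceq> z \<leadsto> y \<otimes> z"
    using residuation[of y z "y \<otimes> z"] by (simp add: rle_refl)
  with assms(1) have "x \<preceq> z \<leadsto> y \<otimes> z"
    by (rule rle_trans) (simp_all add: imp_closed)
  then show ?thesis
    using residuation[of x z "y \<otimes> z"] by simp
qed

lemma mult_mono:
  assumes "x \<preceq> x'" "y \<preceq> y'"
    and [simp]: "x \<in> carrier L" "y \<in> carrier L" "x' \<in> carrier L" "y' \<in> carrier L"
  shows "x \<otimes> y \<preceq> x' \<otimes> y'"
proof (rule rle_trans)
  show "x \<otimes> y \<preceq> x' \<otimes> y"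
    using assms by (intro mult_mono_left) auto
  show "x' \<otimes> y \<preceq> x' \<otimes> y'"
    using mult_mono_left[OF assms(2), of x'] by (simp add: m_comm)
qed auto

text \<open>The unit is the top element, so replacing the factor \<open>y\<close> by
  \<open>\<one>\<close> can only enlarge the product.\<close>

lemma mult_rle1: "\<lbrakk>x \<in> carrier L; y \<in> carrier L\<rbrakk> \<Longrightarrow> x \<otimes> y \<preceq> x"
  using mult_mono[of x x y \<one>] by (simp add: rle_refl one_greatest)

lemma mult_rle2: "\<lbrakk>x \<in> carrier L; y \<in> carrier L\<rbrakk> \<Longrightarrow> x \<otimes> y \<preceq> y"
  using mult_rle1[of y x] by (simp add: m_comm)

lemma imp_mult_rle: "\<lbrakk>x \<in> carrier L; y \<in> carrier L\<rbrakk> \<Longrightarrow> (x \<leadsto> y) \<otimes> x \<preceq> y"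
  using residuation[of "x \<leadsto> y" x y] by (simp add: rle_refl imp_closed)

text \<open>Residuation applied to \<open>\<one> \<otimes> x \<preceq> y\<close>. This turns two
  trivial implications into an equality in \<open>eq_if_filter_class_eq\<close>.\<close>

lemma imp_eq_one_iff: "\<lbrakk>x \<in> carrier L; y \<in> carrier L\<rbrakk> \<Longrightarrow> x \<leadsto> y = \<one> \<longleftrightarrow> x \<preceq> y"
  by (metis imp_closed l_one one_closed one_greatest residuation rle_antisym rle_refl)

lemma one_imp: "x \<in> carrier L \<Longrightarrow> \<one> \<leadsto> x = x"
  by (metis imp_closed imp_mult_rle one_closed r_one residuation rle_antisym rle_refl)

section \<open>The preorder induced by a filter\<close>

context
  fixes F
  assumes F: "rl_filter L F"
begin

lemma filter_carrier: "f \<in> F \<Longrightarrow> f \<in> carrier L"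
  using F by (auto simp: rl_filter_def)

lemma filter_mult: "\<lbrakk>f \<in> F; g \<in> F\<rbrakk> \<Longrightarrow> f \<otimes> g \<in> F"
  using F by (auto simp: rl_filter_def)

lemma filter_up: "\<lbrakk>f \<in> F; f \<preceq> x; x \<in> carrier L\<rbrakk> \<Longrightarrow> x \<in> F"
  using F by (auto simp: rl_filter_def)

lemma filter_one: "\<one> \<in> F"
proof -
  obtain f where "f \<in> F"
    using F by (auto simp: rl_filter_def)
  then show ?thesis
    using filter_up[OF _ one_greatest] filter_carrier by simp
qed

text \<open>The form with an explicit witness is chosen because witnesses can be multiplied:
  \<open>f \<otimes> g\<close> stays in \<open>F\<close> and lies below both factors.\<close>

definition fle :: "'a \<Rightarrow> 'a \<Rightarrow> bool"
  where "fle x y \<longleftrightarrow> (\<exists>f\<in>F. f \<otimes> x \<preceq> y)"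

text \<open>From left to right the witness is \<open>x \<leadsto> y\<close> itself; conversely
  residuation puts the witness below \<open>x \<leadsto> y\<close>, and \<open>F\<close> is upward
  closed.\<close>

lemma imp_in_filter_iff:
  assumes "x \<in> carrier L" "y \<in> carrier L"
  shows "x \<leadsto> y \<in> F \<longleftrightarrow> fle x y"
  unfolding fle_def using assms
  by (meson filter_carrier filter_up imp_closed imp_mult_rle residuation)

text \<open>A product lies below both factors, so it belongs to \<open>F\<close> exactly when both
  do; this splits the congruence into two preorder relations.\<close>

lemma filter_cong_iff:
  "(x, y) \<in> filter_cong L F \<longleftrightarrow> x \<in> carrier L \<and> y \<in> carrier L \<and> fle x y \<and> fle y x"
proof -
  have "a \<otimes> b \<in> F \<longleftrightarrow> a \<in> F \<and> b \<in> F" if "a \<in> carrier L" "b \<in> carrier L" for a b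
    using that by (metis filter_mult filter_up mult_rle1 mult_rle2)
  then show ?thesis
    by (auto simp: filter_cong_def imp_closed simp flip: imp_in_filter_iff)
qed

lemma fle_if_rle: "\<lbrakk>x \<preceq> y; x \<in> carrier L\<rbrakk> \<Longrightarrow> fle x y"
  unfolding fle_def using filter_one by (metis l_one)

lemma fle_trans:
  assumes "fle x y" "fle y z" and [simp]: "x \<in> carrier L" "y \<in> carrier L" "z \<in> carrier L"
  shows "fle x z"
proof -
  obtain f g where fg: "f \<in> F" "g \<in> F" "f \<otimes> x \<preceq> y" "g \<otimes> y \<preceq> z"
    using assms by (auto simp: fle_def)
  note [simp] = fg(1,2)[THEN filter_carrier]
  have "g \<otimes> (f \<otimes> x) \<preceq> g \<otimes> y"
    using fg by (intro mult_mono) (auto simp: rle_refl)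
  then have "(g \<otimes> f) \<otimes> x \<preceq> z"
    using fg(4) by (metis (no_types, lifting) rle_trans m_assoc m_closed fg(1,2) filter_carrier assms(3-5))
  then show ?thesis
    unfolding fle_def using fg filter_mult by blast
qed

lemma fle_mult:
  assumes "fle x x'" "fle y y'"
    and [simp]: "x \<in> carrier L" "y \<in> carrier L" "x' \<in> carrier L" "y' \<in> carrier L"
  shows "fle (x \<otimes> y) (x' \<otimes> y')"
proof -
  obtain f g where fg: "f \<in> F" "g \<in> F" "f \<otimes> x \<preceq> x'" "g \<otimes> y \<preceq> y'"
    using assms by (auto simp: fle_def)
  note [simp] = fg(1,2)[THEN filter_carrier]
  have "(f \<otimes> x) \<otimes> (g \<otimes> y) \<preceq> x' \<otimes> y'"
    using fg by (intro mult_mono) auto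
  then have "(f \<otimes> g) \<otimes> (x \<otimes> y) \<preceq> x' \<otimes> y'"
    by (simp add: m_ac)
  then show ?thesis
    unfolding fle_def using fg filter_mult by blast
qed

lemma fle_meetI:
  assumes "fle z x" "fle z y" and [simp]: "x \<in> carrier L" "y \<in> carrier L" "z \<in> carrier L"
  shows "fle z (x \<curlywedge> y)"
proof -
  obtain f g where fg: "f \<in> F" "g \<in> F" "f \<otimes> z \<preceq> x" "g \<otimes> z \<preceq> y"
    using assms by (auto simp: fle_def)
  note [simp] = fg(1,2)[THEN filter_carrier]
  \<comment> \<open>One common witness for both bounds is obtained by shrinking \<open>f\<close> and
    \<open>g\<close> to their product.\<close>
  have "(f \<otimes> g) \<otimes> z \<preceq> f \<otimes> z" "(f \<otimes> g) \<otimes> z \<preceq> g \<otimes> z"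
    by (intro mult_mono_left mult_rle1 mult_rle2; simp)+
  then have "(f \<otimes> g) \<otimes> z \<preceq> x" "(f \<otimes> g) \<otimes> z \<preceq> y"
    using rle_trans[OF _ fg(3)] rle_trans[OF _ fg(4)] by simp_all
  then show ?thesis
    unfolding fle_def using fg filter_mult by (auto intro!: rle_meetI)
qed

text \<open>By associativity the same witness serves on both sides.\<close>

lemma fle_residuation:
  assumes [simp]: "x \<in> carrier L" "y \<in> carrier L" "z \<in> carrier L"
  shows "fle (x \<otimes> y) z \<longleftrightarrow> fle x (y \<leadsto> z)"
proof -
  have "f \<otimes> (x \<otimes> y) \<preceq> z \<longleftrightarrow> f \<otimes> x \<preceq> y \<leadsto> z" if "f \<in> F" for f
    using filter_carrier[OF that] residuation[of "f \<otimes> x" y z] by (simp add: m_assoc)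
  then show ?thesis
    by (simp add: fle_def)
qed

lemma join_fleI:
  assumes "fle x z" "fle y z" and [simp]: "x \<in> carrier L" "y \<in> carrier L" "z \<in> carrier L"
  shows "fle (x \<curlyvee> y) z"
proof -
  obtain f g where fg: "f \<in> F" "g \<in> F" "f \<otimes> x \<preceq> z" "g \<otimes> y \<preceq> z"
    using assms by (auto simp: fle_def)
  note [simp] = fg(1,2)[THEN filter_carrier]
  have "(f \<otimes> g) \<otimes> x \<preceq> f \<otimes> x" "(f \<otimes> g) \<otimes> y \<preceq> g \<otimes> y"
    by (intro mult_mono_left mult_rle1 mult_rle2; simp)+
  then have "(f \<otimes> g) \<otimes> x \<preceq> z" "(f \<otimes> g) \<otimes> y \<preceq> z"
    using rle_trans[OF _ fg(3)] rle_trans[OF _ fg(4)] by simp_all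
  then have "x \<otimes> (f \<otimes> g) \<preceq> z" "y \<otimes> (f \<otimes> g) \<preceq> z"
    by (simp_all add: m_ac)
  \<comment> \<open>Multiplication by \<open>f \<otimes> g\<close> is a left adjoint: moving it to
    the right leaves plain bounds on \<open>x\<close> and \<open>y\<close>, which combine to a bound
    on the join.\<close>
  then have "x \<curlyvee> y \<preceq> (f \<otimes> g) \<leadsto> z"
    by (auto intro!: join_rleI simp: residuation imp_closed)
  then have "(x \<curlyvee> y) \<otimes> (f \<otimes> g) \<preceq> z"
    by (simp add: residuation join_closed)
  then have "(f \<otimes> g) \<otimes> (x \<curlyvee> y) \<preceq> z"
    by (simp add: m_comm join_closed)
  then show ?thesis
    unfolding fle_def using fg filter_mult by blast
qed

lemma fle_meet:
  assumes "fle x x'" "fle y y'"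
    and [simp]: "x \<in> carrier L" "y \<in> carrier L" "x' \<in> carrier L" "y' \<in> carrier L"
  shows "fle (x \<curlywedge> y) (x' \<curlywedge> y')"
  using assms fle_trans[OF fle_if_rle[OF meet_rle1]] fle_trans[OF fle_if_rle[OF meet_rle2]]
  by (auto intro!: fle_meetI simp: meet_closed)

lemma fle_join:
  assumes "fle x x'" "fle y y'"
    and [simp]: "x \<in> carrier L" "y \<in> carrier L" "x' \<in> carrier L" "y' \<in> carrier L"
  shows "fle (x \<curlyvee> y) (x' \<curlyvee> y')"
  using assms fle_trans[OF _ fle_if_rle[OF rle_join1]] fle_trans[OF _ fle_if_rle[OF rle_join2]]
  by (auto intro!: join_fleI simp: join_closed)

text \<open>By residuation it is enough to bound \<open>(x \<leadsto> y) \<otimes> x'\<close>;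
  replace \<open>x'\<close> by the larger \<open>x\<close>, then apply
  \<open>imp_mult_rle\<close>.\<close>

lemma fle_imp:
  assumes "fle x' x" "fle y y'"
    and [simp]: "x \<in> carrier L" "y \<in> carrier L" "x' \<in> carrier L" "y' \<in> carrier L"
  shows "fle (x \<leadsto> y) (x' \<leadsto> y')"
proof -
  have "fle ((x \<leadsto> y) \<otimes> x') ((x \<leadsto> y) \<otimes> x)"
    using assms(1) by (intro fle_mult fle_if_rle[OF rle_refl]) (auto simp: imp_closed)
  moreover have "fle ((x \<leadsto> y) \<otimes> x) y"
    by (intro fle_if_rle imp_mult_rle) (auto simp: imp_closed)
  ultimately have "fle ((x \<leadsto> y) \<otimes> x') y'"
    using assms(2) by (meson fle_trans assms(3-6) imp_closed m_closed)
  then show ?thesis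
    by (simp add: fle_residuation imp_closed)
qed

section \<open>The congruence and its classes\<close>

lemma equiv_filter_cong: "equiv (carrier L) (filter_cong L F)"
proof (rule equivI)
  show "trans (filter_cong L F)"
    by (rule transI) (auto simp: filter_cong_iff intro: fle_trans)
qed (auto simp: filter_cong_iff refl_on_def sym_def fle_if_rle rle_refl)

lemma filter_class_eq_iff:
  assumes "x \<in> carrier L" "y \<in> carrier L"
  shows "filter_class L F x = filter_class L F y \<longleftrightarrow> fle x y \<and> fle y x"
  using eq_equiv_class_iff[OF equiv_filter_cong assms] assms
  by (simp add: filter_class_def filter_cong_iff)

text \<open>Membership is expressed as equality of classes, so that later arguments about the
  partition become equational.\<close>

lemma mem_filter_class_iff:
  assumes "x \<in> carrier L"
  shows "y \<in> filter_class L F x \<longleftrightarrow>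
    y \<in> carrier L \<and> filter_class L F y = filter_class L F x"
proof -
  have "y \<in> filter_class L F x \<longleftrightarrow> y \<in> carrier L \<and> fle x y \<and> fle y x"
    using assms by (simp add: filter_class_def filter_cong_iff)
  then show ?thesis
    using filter_class_eq_iff[of y x] assms by blast
qed

text \<open>\<open>x \<preceq> \<one>\<close> always holds, and the other relation amounts to
  \<open>\<one> \<leadsto> x \<in> F\<close>, where \<open>\<one> \<leadsto> x = x\<close>.\<close>

lemma filter_class_eq_one_iff:
  assumes "x \<in> carrier L"
  shows "filter_class L F x = filter_class L F \<one> \<longleftrightarrow> x \<in> F"
  using assms imp_in_filter_iff[of \<one> x]
  by (simp add: filter_class_eq_iff one_imp fle_if_rle one_greatest)

text \<open>The compatibility premise assumes equivalent arguments, which covers monotone and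
  antitone operations alike. It concludes only one inequality; the reverse comes from exchanging the
  primed and unprimed arguments.\<close>

lemma lift2_filter_class:
  assumes "\<And>x y. \<lbrakk>x \<in> carrier L; y \<in> carrier L\<rbrakk> \<Longrightarrow> f x y \<in> carrier L"
    and "\<And>x x' y y'. \<lbrakk>fle x x'; fle x' x; fle y y'; fle y' y; x \<in> carrier L; y \<in> carrier L;
      x' \<in> carrier L; y' \<in> carrier L\<rbrakk> \<Longrightarrow> fle (f x y) (f x' y')"
    and "x \<in> carrier L" "y \<in> carrier L"
  shows "lift2_class L F f (filter_class L F x) (filter_class L F y) = filter_class L F (f x y)"
proof -
  have "filter_class L F (f a b) = filter_class L F (f x y)"
    if "a \<in> filter_class L F x" "b \<in> filter_class L F y" for a b
    using that assms by (auto simp: mem_filter_class_iff filter_class_eq_iff)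
  \<comment> \<open>All classes in the union coincide; these representatives show that the union is
    over a nonempty index set.\<close>
  moreover have "x \<in> filter_class L F x" "y \<in> filter_class L F y"
    using assms by (simp_all add: mem_filter_class_iff)
  ultimately show ?thesis
    unfolding lift2_class_def by blast
qed

section \<open>The quotient residuated lattice\<close>

lemma carrier_quotient: "carrier (rl_quotient L F) = filter_class L F ` carrier L"
  by (auto simp: rl_quotient_def quotient_def filter_class_def)

lemma quotient_ops:
  assumes "x \<in> carrier L" "y \<in> carrier L"
  shows "filter_class L F x \<otimes>\<^bsub>rl_quotient L F\<^esub> filter_class L F y = filter_class L F (x \<otimes> y)"
    and "filter_class L F x \<curlywedge>\<^bsub>rl_quotient L F\<^esub> filter_class L F y = filter_class L F (x \<curlywedge> y)"
    and "filter_class L F x \<curlyvee>\<^bsub>rl_quotient L F\<^esub> filter_class L F y = filter_class L F (x \<curlyvee> y)"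
    and "filter_class L F x \<leadsto>\<^bsub>rl_quotient L F\<^esub> filter_class L F y = filter_class L F (x \<leadsto> y)"
  unfolding rl_quotient_def using assms
  by (simp_all add: lift2_filter_class rl_closed fle_mult fle_meet fle_join fle_imp)

lemma quotient_consts:
  "\<one>\<^bsub>rl_quotient L F\<^esub> = filter_class L F \<one>" "\<zero>\<^bsub>rl_quotient L F\<^esub> = filter_class L F \<zero>"
  by (simp_all add: rl_quotient_def)

text \<open>The left side says that \<open>x \<curlywedge> y\<close> and \<open>x\<close> are
  equivalent. Since \<open>x \<curlywedge> y\<close> is below \<open>x\<close> anyway, only
  \<open>fle x (x \<curlywedge> y)\<close> matters.\<close>

lemma quotient_rle_iff:
  assumes "x \<in> carrier L" "y \<in> carrier L"
  shows "filter_class L F x \<preceq>\<^bsub>rl_quotient L F\<^esub> filter_class L F y \<longleftrightarrow> fle x y"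
proof -
  have "fle (x \<curlywedge> y) x" "fle (x \<curlywedge> y) y" "fle x x"
    using assms by (auto intro!: fle_if_rle meet_rle1 meet_rle2 rle_refl simp: meet_closed)
  then show ?thesis
    using assms fle_trans[of x "x \<curlywedge> y" y]
    by (auto simp: rle_def quotient_ops filter_class_eq_iff meet_closed intro!: fle_meetI)
qed

lemma residuated_lattice_quotient: "residuated_lattice (rl_quotient L F)"
proof -
  interpret Q: comm_monoid "rl_quotient L F"
    by unfold_locales (auto simp: carrier_quotient quotient_consts quotient_ops m_ac)
  show ?thesis
    \<comment> \<open>Each axiom is reduced to representatives. Residuation becomes
      \<open>fle_residuation\<close>; the second simplification handles commutativity of meet and
      join.\<close>
    by (unfold_locales; unfold carrier_quotient quotient_consts; (elim imageE)?;
        simp add: quotient_ops quotient_rle_iff rl_closed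
          meet_assoc join_assoc meet_join_absorb join_meet_absorb
          fle_residuation fle_if_rle bot_least one_greatest;
        simp add: meet_comm join_comm)
qed

section \<open>Separation and the intersection of the filters\<close>

lemma openin_filter_class:
  assumes "filter_system L \<F>" "F \<in> \<F>" "x \<in> carrier L"
  shows "openin (filter_topology L \<F>) (filter_class L F x)"
  \<comment> \<open>Every point of a class has that same class, so \<open>F\<close> is the witness
    at each point.\<close>
  using assms mem_filter_class_iff by (auto simp: openin_filter_topology)

end

text \<open>Equal classes put both implications into every filter, hence into the trivial
  intersection.\<close>

lemma eq_if_filter_class_eq:
  assumes "filter_system L \<F>" "\<Inter> \<F> = {\<one>}" "x \<in> carrier L" "y \<in> carrier L"
    and "\<And>F. F \<in> \<F> \<Longrightarrow> filter_class L F x = filter_class L F y"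
  shows "x = y"
proof -
  have "x \<leadsto> y \<in> F \<and> y \<leadsto> x \<in> F" if "F \<in> \<F>" for F
    using that assms by (simp add: filter_system_def imp_in_filter_iff filter_class_eq_iff)
  then have "x \<leadsto> y = \<one>" "y \<leadsto> x = \<one>"
    using assms(2) by blast+
  then show ?thesis
    using assms by (simp add: imp_eq_one_iff rle_antisym)
qed

lemma Hausdorff_filter_topology:
  assumes fs: "filter_system L \<F>" and "\<Inter> \<F> = {\<one>}"
  shows "Hausdorff_space (filter_topology L \<F>)"
  unfolding Hausdorff_space_def topspace_filter_topology[OF fs]
proof (intro allI impI)
  fix x y
  assume xy: "x \<in> carrier L \<and> y \<in> carrier L \<and> x \<noteq> y"
  then obtain F where F: "F \<in> \<F>" "filter_class L F x \<noteq> filter_class L F y"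
    using eq_if_filter_class_eq[OF assms] by blast
  then have filt: "rl_filter L F"
    using fs by (simp add: filter_system_def)
  let ?U = "filter_class L F x" and ?V = "filter_class L F y"
  have "openin (filter_topology L \<F>) ?U" "openin (filter_topology L \<F>) ?V"
    using xy by (simp_all add: openin_filter_class[OF filt fs F(1)])
  moreover have "x \<in> ?U" "y \<in> ?V"
    using xy by (simp_all add: mem_filter_class_iff[OF filt])
  moreover have "disjnt ?U ?V"
    using xy F(2) mem_filter_class_iff[OF filt] by (metis disjnt_iff)
  ultimately show "\<exists>U V. openin (filter_topology L \<F>) U \<and> openin (filter_topology L \<F>) V \<and>
      x \<in> U \<and> y \<in> V \<and> disjnt U V"
    by blast
qed

lemma Inter_filters_if_t0:
  assumes fs: "filter_system L \<F>" and t0: "t0_space (filter_topology L \<F>)"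
  shows "\<Inter> \<F> = {\<one>}"
proof -
  have filt: "rl_filter L F" if "F \<in> \<F>" for F
    using fs that by (simp add: filter_system_def)
  \<comment> \<open>A member of the family places the points of the intersection in
    \<open>carrier L\<close>.\<close>
  obtain G where "G \<in> \<F>"
    using fs by (auto simp: filter_system_def)
  have "a = \<one>" if a: "a \<in> \<Inter> \<F>" for a
  proof (rule ccontr)
    assume "a \<noteq> \<one>"
    have aL: "a \<in> carrier L"
      using a \<open>G \<in> \<F>\<close> filt filter_carrier by blast
    \<comment> \<open>The biconditional says that \<open>U\<close> contains exactly one of the two
      points.\<close>
    obtain U where U: "openin (filter_topology L \<F>) U" "a \<notin> U \<longleftrightarrow> \<one> \<in> U"
      using t0 aL \<open>a \<noteq> \<one>\<close> unfolding t0_space_def topspace_filter_topology[OF fs]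
      by (metis one_closed)
    have "filter_class L F a = filter_class L F \<one>" if "F \<in> \<F>" for F
      using that filt a aL by (simp add: filter_class_eq_one_iff)
    \<comment> \<open>Both memberships are recorded because \<open>U\<close> may contain either
      point; a basic neighbourhood of that point inside \<open>U\<close> then captures the
      other.\<close>
    then have "a \<in> filter_class L F \<one> \<and> \<one> \<in> filter_class L F a" if "F \<in> \<F>" for F
      using that filt aL by (simp add: mem_filter_class_iff)
    with U show False
      unfolding openin_filter_topology[OF fs] by (metis subsetD)
  qed
  then show ?thesis
    using filt filter_one by blast
qed

section \<open>The natural map into the product of the quotients\<close>

lemma rl_hom_natural_map:
  assumes "\<And>i. i \<in> I \<Longrightarrow> rl_filter L (F i)"
  shows "natural_map L I F \<in> rl_hom L (rl_product I (\<lambda>i. rl_quotient L (F i)))"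
  using assms
  by (simp add: rl_hom_def hom_def Pi_iff natural_map_def rl_product_def carrier_quotient
      quotient_ops quotient_consts cong: restrict_cong)

text \<open>The natural map is a homomorphism onto each factor for any family of filters, so the
  equivalence reduces to injectivity.\<close>

lemma Inter_filters_iff_subdirect_product:
  assumes fs: "filter_system L (F ` I)"
  shows "(\<Inter>i\<in>I. F i) = {\<one>} \<longleftrightarrow>
    subdirect_product_via L I (\<lambda>i. rl_quotient L (F i)) (natural_map L I F)"
proof -
  have filt: "rl_filter L (F i)" if "i \<in> I" for i
    using fs that by (simp add: filter_system_def)
  obtain j where "j \<in> I"
    using fs by (auto simp: filter_system_def)
  have map_eq: "natural_map L I F x = natural_map L I F y \<longleftrightarrow>
      (\<forall>i\<in>I. filter_class L (F i) x = filter_class L (F i) y)" for x y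
    by (auto simp: natural_map_def restrict_def fun_eq_iff)
  have "(\<Inter>i\<in>I. F i) = {\<one>} \<longleftrightarrow> inj_on (natural_map L I F) (carrier L)"
  proof
    assume "(\<Inter>i\<in>I. F i) = {\<one>}"
    then show "inj_on (natural_map L I F) (carrier L)"
      by (intro inj_onI eq_if_filter_class_eq[OF fs]) (auto simp: map_eq)
  next
    assume inj: "inj_on (natural_map L I F) (carrier L)"
    \<comment> \<open>Elements of the intersection are those with the same image as
      \<open>\<one>\<close>, so injectivity is tested against \<open>\<one>\<close>.\<close>
    have "a = \<one>" if a: "\<forall>i\<in>I. a \<in> F i" for a
    proof -
      have "a \<in> carrier L"
        using a \<open>j \<in> I\<close> filt filter_carrier by blast
      moreover from this have "natural_map L I F a = natural_map L I F \<one>"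
        using a by (simp add: map_eq filt filter_class_eq_one_iff)
      ultimately show ?thesis
        using inj by (simp add: inj_on_def)
    qed
    then show "(\<Inter>i\<in>I. F i) = {\<one>}"
      using filt filter_one by blast
  qed
  moreover have "(\<lambda>x. natural_map L I F x i) ` carrier L = carrier (rl_quotient L (F i))"
    if "i \<in> I" for i
    using that filt by (simp add: natural_map_def carrier_quotient)
  ultimately show ?thesis
    unfolding subdirect_product_via_def subdirect_embedding_def
    using filt residuated_lattice_quotient rl_hom_natural_map[of I F] residuated_lattice_axioms
    by simp
qed

end

theorem theorem4p5:
  fixes L :: "('a, 'b) rlattice_scheme" and I :: "'i set" and F :: "'i \<Rightarrow> 'a set"
  assumes "residuated_lattice L"
    and "filter_system L (F ` I)"
  shows "(Hausdorff_space (filter_topology L (F ` I)) \<longleftrightarrow> t1_space (filter_topology L (F ` I)))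
    \<and> (t1_space (filter_topology L (F ` I)) \<longleftrightarrow> t0_space (filter_topology L (F ` I)))
    \<and> (t0_space (filter_topology L (F ` I)) \<longleftrightarrow> (\<Inter>i\<in>I. F i) = {\<one>\<^bsub>L\<^esub>})
    \<and> ((\<Inter>i\<in>I. F i) = {\<one>\<^bsub>L\<^esub>} \<longleftrightarrow>
        subdirect_product_via L I (\<lambda>i. rl_quotient L (F i)) (natural_map L I F))"
proof -
  interpret residuated_lattice L by fact
  let ?T = "filter_topology L (F ` I)"
  \<comment> \<open>The separation axioms and the trivial intersection are linked in a cycle, to
    which the subdirect representation is then attached.\<close>
  have "t0_space ?T \<Longrightarrow> (\<Inter>i\<in>I. F i) = {\<one>\<^bsub>L\<^esub>}"
    using assms(2) by (rule Inter_filters_if_t0)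
  moreover have "(\<Inter>i\<in>I. F i) = {\<one>\<^bsub>L\<^esub>} \<Longrightarrow> Hausdorff_space ?T"
    using assms(2) by (rule Hausdorff_filter_topology)
  moreover have "Hausdorff_space ?T \<Longrightarrow> t1_space ?T" "t1_space ?T \<Longrightarrow> t0_space ?T"
    by (simp_all add: Hausdorff_imp_t1_space t1_imp_t0_space)
  ultimately show ?thesis
    using Inter_filters_iff_subdirect_product[OF assms(2)] by argo
qed

end
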